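(* Let $(X,* )$ be a finite quandle whose decomposition into orbits under $\mathrm{Inn}(X)$ is $X=X_1\cup\{a\}$. Then there exists a unique non-trivial $T_0$-topology on $X$ which makes $X$ right continuous, i.e. which makes all right multiplications $R_y:X\to X$, $R_y(x)=x*y$, continuous.
   Context: A quandle is a set $X$ with a binary operation $*$ such that: (1) $x*x=x$ for all $x$; (2) for all $y,z\in X$ there is a unique $x\in X$ with $x*y=z$; (3) $(x*y)*z=(x*z)*(y*z)$ for all $x,y,z$. The right multiplications $R_y$ are automorphisms of $X$; the subgroup of the automorphism group they generate is the inner automorphism group $\mathrm{Inn}(X)$, and the orbits of $X$ are the orbits of its action on $X$; here the orbits are $X_1$ and $\{a\}$. For a finite topological space $X$ and $x\in X$, $U_x$ denotes the smallest open subset of $X$ containing $x$. If $X$ is $T_0$, the associated partial order is defined by $x\leq y$ if and only if $U_y\subseteq U_x$; this gives a one-to-one correspondence between $T_0$-topologies and partial orders on the finite set $X$, under which a map is continuous if and only if it is order-preserving. "Non-trivial" means non-discrete, i.e. some two distinct elements are comparable in the associated order. The topology in the statement is specified as the one whose associated order is given by $x<a$ for all $x\in X_1$.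
   Formalization: Uniqueness fails as written since the reverse order a<x also gives such a topology (e.g. two-point trivial quandle); proved: uniqueness among those with x<a for all x in X_1, and that any non-trivial T_0 right continuous topology has this order or its reverse; X_1 is taken distinct from {a}. *)

theory Defs
  imports "HOL-Algebra.Group_Action" "HOL-Algebra.Generated_Groups" "HOL-Analysis.Analysis"
begin

locale quandle =
  fixes X :: "'a set" and qop :: "'a \<Rightarrow> 'a \<Rightarrow> 'a" (infixl \<open>\<star>\<close> 70)
  assumes closed: "x \<in> X \<Longrightarrow> y \<in> X \<Longrightarrow> x \<star> y \<in> X"
    and idem: "x \<in> X \<Longrightarrow> x \<star> x = x"
    and right_bij: "y \<in> X \<Longrightarrow> z \<in> X \<Longrightarrow> \<exists>!x. x \<in> X \<and> x \<star> y = z"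
    and right_distrib:
      "x \<in> X \<Longrightarrow> y \<in> X \<Longrightarrow> z \<in> X \<Longrightarrow> (x \<star> y) \<star> z = (x \<star> z) \<star> (y \<star> z)"

definition right_mult :: "'a set \<Rightarrow> ('a \<Rightarrow> 'a \<Rightarrow> 'a) \<Rightarrow> 'a \<Rightarrow> 'a \<Rightarrow> 'a" where
  "right_mult X qop y = (\<lambda>x\<in>X. qop x y)"

definition quandle_Aut :: "'a set \<Rightarrow> ('a \<Rightarrow> 'a \<Rightarrow> 'a) \<Rightarrow> ('a \<Rightarrow> 'a) monoid" where
  "quandle_Aut X qop =
     (BijGroup X)\<lparr>carrier := {f \<in> Bij X. \<forall>x\<in>X. \<forall>y\<in>X. f (qop x y) = qop (f x) (f y)}\<rparr>"

definition quandle_Inn :: "'a set \<Rightarrow> ('a \<Rightarrow> 'a \<Rightarrow> 'a) \<Rightarrow> ('a \<Rightarrow> 'a) monoid" where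
  "quandle_Inn X qop =
     (quandle_Aut X qop)\<lparr>carrier := generate (quandle_Aut X qop) (right_mult X qop ` X)\<rparr>"

text \<open>The action of the inner automorphism group is evaluation, hence the identity as action map.\<close>

definition quandle_orbits :: "'a set \<Rightarrow> ('a \<Rightarrow> 'a \<Rightarrow> 'a) \<Rightarrow> 'a set set" where
  "quandle_orbits X qop = orbits (quandle_Inn X qop) X (\<lambda>g. g)"

definition right_continuous :: "'a set \<Rightarrow> ('a \<Rightarrow> 'a \<Rightarrow> 'a) \<Rightarrow> 'a topology \<Rightarrow> bool" where
  "right_continuous X qop T \<longleftrightarrow> (\<forall>y\<in>X. continuous_map T T (right_mult X qop y))"

text \<open>The intersection of all open neighbourhoods of a point is its smallest open neighbourhood
  when the space is finite; see \<open>openin_min_open\<close> below.\<close>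

definition min_open :: "'a topology \<Rightarrow> 'a \<Rightarrow> 'a set" where
  "min_open T x = \<Inter>{U. openin T U \<and> x \<in> U}"

definition top_le :: "'a topology \<Rightarrow> 'a \<Rightarrow> 'a \<Rightarrow> bool" where
  "top_le T x y \<longleftrightarrow> x \<in> topspace T \<and> y \<in> topspace T \<and> min_open T y \<subseteq> min_open T x"

definition top_less :: "'a topology \<Rightarrow> 'a \<Rightarrow> 'a \<Rightarrow> bool" where
  "top_less T x y \<longleftrightarrow> top_le T x y \<and> x \<noteq> y"

lemma in_min_open: "x \<in> min_open T x"
  by (simp add: min_open_def)

lemma min_open_subset: "openin T U \<Longrightarrow> x \<in> U \<Longrightarrow> min_open T x \<subseteq> U"
  by (auto simp: min_open_def)

lemma openin_min_open:
  assumes "finite (topspace T)" "x \<in> topspace T"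
  shows "openin T (min_open T x)"
  unfolding min_open_def
proof (rule openin_Inter)
  have "{U. openin T U \<and> x \<in> U} \<subseteq> Pow (topspace T)"
    using openin_subset by blast
  then show "finite {U. openin T U \<and> x \<in> U}"
    using assms(1) by (meson finite_Pow_iff finite_subset)
  show "{U. openin T U \<and> x \<in> U} \<noteq> {}"
    using assms(2) by blast
qed auto

lemma nondiscrete_iff_comparable:
  assumes "finite (topspace T)"
  shows "T \<noteq> discrete_topology (topspace T) \<longleftrightarrow> (\<exists>x y. top_less T x y)"
proof -
  have "T = discrete_topology (topspace T) \<longleftrightarrow> (\<forall>x\<in>topspace T. openin T {x})"
    using discrete_topology_unique[of "topspace T" T] by auto
  moreover have "openin T {x} \<longleftrightarrow> (\<forall>y. \<not> top_less T x y)" if x: "x \<in> topspace T" for x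
  proof
    assume "openin T {x}"
    then have "min_open T x \<subseteq> {x}"
      by (simp add: min_open_subset)
    then show "\<forall>y. \<not> top_less T x y"
      using in_min_open by (fastforce simp: top_less_def top_le_def)
  next
    assume *: "\<forall>y. \<not> top_less T x y"
    note o = openin_min_open[OF assms x]
    have "y = x" if "y \<in> min_open T x" for y
      using * min_open_subset[OF o that] x that openin_subset[OF o]
      by (auto simp: top_less_def top_le_def)
    then have "min_open T x = {x}"
      using in_min_open by fastforce
    then show "openin T {x}"
      using o by simp
  qed
  moreover have "x \<in> topspace T" if "top_less T x y" for x y
    using that by (simp add: top_less_def top_le_def)
  ultimately show ?thesis
    by blast
qed

context quandle
begin

lemma right_mult_in_Bij:
  assumes y: "y \<in> X" shows "right_mult X qop y \<in> Bij X"
proof -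
  have "bij_betw (right_mult X qop y) X X"
    unfolding bij_betw_def
  proof
    show "inj_on (right_mult X qop y) X"
    proof (rule inj_onI)
      fix u v assume uv: "u \<in> X" "v \<in> X" "right_mult X qop y u = right_mult X qop y v"
      then show "u = v"
        using right_bij[OF y closed[OF uv(2) y]] by (auto simp: right_mult_def)
    qed
    show "right_mult X qop y ` X = X"
    proof
      show "right_mult X qop y ` X \<subseteq> X"
        using closed y by (auto simp: right_mult_def)
      show "X \<subseteq> right_mult X qop y ` X"
      proof
        fix z assume "z \<in> X"
        then obtain x where "x \<in> X" "x \<star> y = z"
          using right_bij[OF y] by blast
        then show "z \<in> right_mult X qop y ` X"
          by (auto simp: right_mult_def image_iff)
      qed
    qed
  qed
  then show ?thesis
    by (simp add: Bij_def right_mult_def)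
qed

lemma right_mult_in_Aut:
  assumes y: "y \<in> X" shows "right_mult X qop y \<in> carrier (quandle_Aut X qop)"
proof -
  have "right_mult X qop y (u \<star> v) = right_mult X qop y u \<star> right_mult X qop y v"
    if "u \<in> X" "v \<in> X" for u v
    using right_distrib[OF that y] that by (simp add: right_mult_def closed)
  then show ?thesis
    using right_mult_in_Bij[OF y] by (simp add: quandle_Aut_def)
qed

lemma subgroup_Aut: "subgroup (carrier (quandle_Aut X qop)) (BijGroup X)"
proof (rule group.subgroupI[OF group_BijGroup])
  let ?A = "carrier (quandle_Aut X qop)"
  show "?A \<subseteq> carrier (BijGroup X)"
    by (auto simp: quandle_Aut_def BijGroup_def)
  have "(\<lambda>x\<in>X. x) \<in> ?A"
    using id_Bij by (auto simp: quandle_Aut_def closed)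
  then show "?A \<noteq> {}" by blast
  show "inv\<^bsub>BijGroup X\<^esub> f \<in> ?A" if f: "f \<in> ?A" for f
  proof -
    have fB: "f \<in> Bij X" and h: "\<And>x y. x \<in> X \<Longrightarrow> y \<in> X \<Longrightarrow> f (x \<star> y) = f x \<star> f y"
      using f by (auto simp: quandle_Aut_def)
    have b: "bij_betw f X X" using fB by (simp add: Bij_def)
    have i: "inv_into X f x \<in> X" "f (inv_into X f x) = x" if "x \<in> X" for x
      using b that by (simp_all add: bij_betw_def inv_into_into f_inv_into_f)
    have "inv_into X f (x \<star> y) = inv_into X f x \<star> inv_into X f y" if "x \<in> X" "y \<in> X" for x y
    proof -
      have "f (inv_into X f x \<star> inv_into X f y) = x \<star> y"
        using h i that by simp
      then show ?thesis
        using bij_betw_inv_into_left[OF b closed[OF i(1)[OF that(1)] i(1)[OF that(2)]]] by simp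
    qed
    then show ?thesis
      using restrict_inv_into_Bij[OF fB] inv_BijGroup[OF fB] by (auto simp: quandle_Aut_def closed)
  qed
  show "f \<otimes>\<^bsub>BijGroup X\<^esub> g \<in> ?A" if "f \<in> ?A" "g \<in> ?A" for f g
  proof -
    have "f \<in> Bij X" "g \<in> Bij X" "g \<in> X \<rightarrow> X"
      using that by (auto simp: quandle_Aut_def Bij_imp_funcset)
    moreover from this have "compose X f g \<in> Bij X"
      by (simp add: compose_Bij)
    ultimately show ?thesis
      using that by (auto simp: quandle_Aut_def BijGroup_def compose_def closed Pi_iff)
  qed
qed

lemma group_Aut: "group (quandle_Aut X qop)"
  using group.subgroup_imp_group[OF group_BijGroup subgroup_Aut]
  by (simp add: quandle_Aut_def)

lemma subgroup_Inn: "subgroup (carrier (quandle_Inn X qop)) (quandle_Aut X qop)"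
  using group.generate_is_subgroup[OF group_Aut] right_mult_in_Aut
  by (simp add: quandle_Inn_def image_subset_iff)

end

end

theory Submission
  imports Defs
begin

text \<open>A continuous bijection of a finite space is a homeomorphism, so every inner automorphism is
  an automorphism of the order and preserves the size of the minimal neighbourhoods. In a finite
  \<open>T\<^sub>0\<close> space this size strictly decreases along the order, hence two distinct points of one orbit
  are incomparable. Only \<open>a\<close> can then be comparable to points of \<open>X1\<close>; transitivity on \<open>X1\<close>
  spreads one comparability to all of \<open>X1\<close>, and \<open>x < a < y\<close> is impossible.\<close>

section \<open>The order of a finite space\<close>

lemma top_le_iff_mem:
  assumes "finite (topspace T)"
  shows "top_le T x y \<longleftrightarrow> x \<in> topspace T \<and> y \<in> min_open T x"
proof -
  have "y \<in> topspace T \<and> min_open T y \<subseteq> min_open T x"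
    if "x \<in> topspace T" "y \<in> min_open T x"
  proof -
    have "openin T (min_open T x)"
      by (rule openin_min_open[OF assms that(1)])
    from min_open_subset[OF this that(2)] openin_subset[OF this] that(2) show ?thesis
      by auto
  qed
  then show ?thesis
    using in_min_open[of y T] by (auto simp: top_le_def)
qed

lemma top_less_trans: "top_less T x y \<Longrightarrow> top_less T y z \<Longrightarrow> x \<noteq> z \<Longrightarrow> top_less T x z"
  by (auto simp: top_less_def top_le_def)

text \<open>In a finite space an open set is the union of the minimal neighbourhoods of its points,
  and these consist of the points above. Uniqueness rests on this: the order determines the
  topology.\<close>

lemma openin_iff_top_less:
  assumes "finite (topspace T)"
  shows "openin T U \<longleftrightarrow> U \<subseteq> topspace T \<and> (\<forall>x\<in>U. \<forall>y. top_less T x y \<longrightarrow> y \<in> U)"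
proof
  assume U: "openin T U"
  then show "U \<subseteq> topspace T \<and> (\<forall>x\<in>U. \<forall>y. top_less T x y \<longrightarrow> y \<in> U)"
    using min_open_subset[OF U] openin_subset[OF U]
    by (auto simp: top_less_def top_le_iff_mem[OF assms])
next
  assume *: "U \<subseteq> topspace T \<and> (\<forall>x\<in>U. \<forall>y. top_less T x y \<longrightarrow> y \<in> U)"
  have "openin T (min_open T x) \<and> x \<in> min_open T x \<and> min_open T x \<subseteq> U" if "x \<in> U" for x
    using * that openin_min_open[OF assms, of x] in_min_open[of x T]
    by (auto simp: top_less_def top_le_iff_mem[OF assms])
  then show "openin T U"
    by (subst openin_subopen) blast
qed

lemma topology_eq_if_top_less_eq:
  assumes "finite (topspace S)" "topspace S = topspace T" "\<And>x y. top_less S x y \<longleftrightarrow> top_less T x y"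
  shows "S = T"
  using assms by (simp add: topology_eq openin_iff_top_less)

text \<open>The \<open>t0_space\<close> axiom makes the inclusion of minimal neighbourhoods strict,
  and finiteness turns this into a drop in cardinality. The number serves as a rank that
  homeomorphisms respect.\<close>

lemma top_less_card_less:
  assumes fin: "finite (topspace T)" and t0: "t0_space T" and less: "top_less T x y"
  shows "card (min_open T y) < card (min_open T x)"
proof (rule psubset_card_mono)
  have xy: "x \<in> topspace T" "y \<in> topspace T" "x \<noteq> y" "min_open T y \<subseteq> min_open T x"
    using less by (auto simp: top_less_def top_le_def)
  show "finite (min_open T x)"
    using fin openin_subset[OF openin_min_open[OF fin xy(1)]] finite_subset by blast
  obtain U where "openin T U" "(x \<in> U) \<noteq> (y \<in> U)"
    using t0 xy unfolding t0_space_def by metis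
  then have "min_open T x \<noteq> min_open T y"
    using in_min_open[of x T] in_min_open[of y T] min_open_subset[of T U] by blast
  then show "min_open T y \<subset> min_open T x"
    using xy by blast
qed

section \<open>Self-homeomorphisms of a finite space\<close>

lemma finite_continuous_bij_homeomorphic_map:
  assumes fin: "finite (topspace T)" and cont: "continuous_map T T f"
    and bij: "bij_betw f (topspace T) (topspace T)"
  shows "homeomorphic_map T T f"
proof (rule bijective_open_imp_homeomorphic_map[OF cont])
  show "f ` topspace T = topspace T" "inj_on f (topspace T)"
    using bij by (auto simp: bij_betw_def)
  define pre where "pre U = {x \<in> topspace T. f x \<in> U}" for U
  have image_pre: "f ` pre U = U" if "openin T U" for U
  proof -
    have "U \<subseteq> f ` topspace T"
      using bij openin_subset[OF that] by (simp add: bij_betw_def)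
    then show ?thesis
      by (auto simp: pre_def)
  qed
  \<comment> \<open>Pigeonhole on open sets instead of points: taking preimages is an injective
    self-map of the finite family of open sets, hence onto. Every open set is then a preimage, and
    its image is open by \<open>image_pre\<close>.\<close>
  have "pre ` {U. openin T U} = {U. openin T U}"
  proof (rule endo_inj_surj)
    show "finite {U. openin T U}"
      by (rule finite_subset[of _ "Pow (topspace T)"]) (auto simp: fin dest: openin_subset)
    show "pre ` {U. openin T U} \<subseteq> {U. openin T U}"
      using cont by (auto simp: pre_def continuous_map_def)
    show "inj_on pre {U. openin T U}"
      by (rule inj_on_inverseI[of _ "image f"]) (simp add: image_pre)
  qed
  then have "\<exists>U. openin T U \<and> V = pre U" if "openin T V" for V
    using that by (metis (mono_tags) imageE mem_Collect_eq)
  then show "open_map T T f"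
    unfolding open_map_def using image_pre by metis
qed

lemma homeomorphic_map_top_less:
  assumes fin: "finite (topspace T)" and f: "homeomorphic_map T T f" and less: "top_less T x y"
  shows "top_less T (f x) (f y)"
proof -
  have xy: "x \<in> topspace T" "y \<in> topspace T" "x \<noteq> y" "y \<in> min_open T x"
    using less in_min_open[of y T] by (auto simp: top_less_def top_le_def)
  have fx: "f x \<in> topspace T"
    using f xy by (metis homeomorphic_imp_surjective_map imageI)
  have "openin T {z \<in> topspace T. f z \<in> min_open T (f x)}"
    using homeomorphic_imp_continuous_map[OF f] openin_min_open[OF fin fx]
    by (auto simp: continuous_map_def)
  then have "min_open T x \<subseteq> {z \<in> topspace T. f z \<in> min_open T (f x)}"
    by (rule min_open_subset) (simp add: xy in_min_open)
  moreover have "f x \<noteq> f y"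
    using homeomorphic_imp_injective_map[OF f] xy by (auto dest: inj_onD)
  ultimately show ?thesis
    using xy fx fin by (auto simp: top_less_def top_le_iff_mem)
qed

text \<open>The image of a minimal neighbourhood is an open neighbourhood of \<open>f x\<close>, so
  it contains the minimal one. The inequality suffices because transitivity on an orbit supplies
  maps in both directions.\<close>

lemma homeomorphic_map_card_min_open:
  assumes fin: "finite (topspace T)" and f: "homeomorphic_map T T f" and x: "x \<in> topspace T"
  shows "card (min_open T (f x)) \<le> card (min_open T x)"
proof -
  have "finite (min_open T x)"
    using openin_subset[OF openin_min_open[OF fin x]] fin finite_subset by blast
  moreover have "openin T (f ` min_open T x)"
    using homeomorphic_imp_open_map[OF f] openin_min_open[OF fin x] by (simp add: open_map_def)
  then have "min_open T (f x) \<subseteq> f ` min_open T x"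
    by (rule min_open_subset) (simp add: in_min_open)
  ultimately show ?thesis
    by (meson card_image_le card_mono finite_imageI le_trans)
qed

text \<open>This lets continuity pass from the generators \<open>R_y\<close> to all of
  \<open>Inn\<close>: a subgroup containing the generators contains the group they generate.\<close>

lemma subgroup_homeomorphic_maps:
  "subgroup {f \<in> Bij (topspace T). homeomorphic_map T T f} (BijGroup (topspace T))"
proof (rule group.subgroupI[OF group_BijGroup])
  let ?X = "topspace T"
  let ?H = "{f \<in> Bij ?X. homeomorphic_map T T f}"
  show "?H \<subseteq> carrier (BijGroup ?X)"
    by (auto simp: BijGroup_def)
  have "homeomorphic_map T T (\<lambda>x\<in>?X. x)"
    using homeomorphic_map_eq[of T T id "\<lambda>x\<in>?X. x"] by simp
  then show "?H \<noteq> {}"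
    using id_Bij by blast
  show "inv\<^bsub>BijGroup ?X\<^esub> f \<in> ?H" if "f \<in> ?H" for f
  proof -
    have fB: "f \<in> Bij ?X" and f: "homeomorphic_map T T f"
      using that by auto
    obtain g where g: "homeomorphic_maps T T f g"
      using f by (auto simp: homeomorphic_map_maps)
    have b: "bij_betw f ?X ?X"
      using fB by (simp add: Bij_def)
    \<comment> \<open>The topological inverse \<open>g\<close> is arbitrary off \<open>?X\<close>,
      while the group inverse is extensional; only agreement on \<open>?X\<close> can be expected,
      and \<open>homeomorphic_map_eq\<close> asks for no more.\<close>
    have "g x = (\<lambda>x\<in>?X. inv_into ?X f x) x" if "x \<in> ?X" for x
    proof -
      have "f (g x) = x" "g x \<in> ?X"
        using g that by (auto simp: homeomorphic_maps_def continuous_map_def Pi_iff)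
      then show ?thesis
        using bij_betw_inv_into_left[OF b] that by force
    qed
    then have "homeomorphic_map T T (\<lambda>x\<in>?X. inv_into ?X f x)"
      using homeomorphic_map_eq[of T T g] g homeomorphic_maps_map by blast
    then show ?thesis
      using restrict_inv_into_Bij[OF fB] inv_BijGroup[OF fB] by simp
  qed
  show "f \<otimes>\<^bsub>BijGroup ?X\<^esub> g \<in> ?H" if "f \<in> ?H" "g \<in> ?H" for f g
  proof -
    have "homeomorphic_map T T (f \<circ> g)"
      using that homeomorphic_map_compose by blast
    then have "homeomorphic_map T T (compose ?X f g)"
      by (rule homeomorphic_map_eq) (simp add: compose_def)
    then show ?thesis
      using that by (auto simp: BijGroup_def compose_Bij)
  qed
qed

section \<open>Inner automorphisms and their orbits\<close>

context quandle
begin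

text \<open>Generation inside a subgroup agrees with generation in the ambient group. Moving to
  \<open>BijGroup X\<close> puts \<open>Inn\<close> in the same group as the subgroup of
  homeomorphisms.\<close>

lemma carrier_Inn:
  "carrier (quandle_Inn X qop) = generate (BijGroup X) (right_mult X qop ` X)"
proof -
  have "quandle_Aut X qop = (BijGroup X)\<lparr>carrier := carrier (quandle_Aut X qop)\<rparr>"
    by (simp add: quandle_Aut_def)
  then show ?thesis
    using group.generate_consistent[OF group_BijGroup _ subgroup_Aut, of "right_mult X qop ` X"]
      right_mult_in_Aut by (auto simp: quandle_Inn_def image_subset_iff)
qed

lemma Inn_subset_Bij: "carrier (quandle_Inn X qop) \<subseteq> Bij X"
  using subgroup.subset[OF subgroup_Inn] by (auto simp: quandle_Aut_def)

lemma right_mult_in_Inn: "y \<in> X \<Longrightarrow> right_mult X qop y \<in> carrier (quandle_Inn X qop)"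
  by (simp add: carrier_Inn generate.incl)

lemma Inn_homeomorphic_map:
  assumes "finite X" and T: "topspace T = X" and rc: "right_continuous X qop T"
    and g: "g \<in> carrier (quandle_Inn X qop)"
  shows "homeomorphic_map T T g"
proof -
  have "homeomorphic_map T T (right_mult X qop y)" if "y \<in> X" for y
    using finite_continuous_bij_homeomorphic_map[of T] right_mult_in_Bij[OF that] that assms
    by (auto simp: right_continuous_def Bij_def)
  then have "right_mult X qop ` X \<subseteq> {f \<in> Bij X. homeomorphic_map T T f}"
    using right_mult_in_Bij by auto
  then have "carrier (quandle_Inn X qop) \<subseteq> {f \<in> Bij X. homeomorphic_map T T f}"
    unfolding carrier_Inn
    using group.generate_subgroup_incl[OF group_BijGroup _ subgroup_homeomorphic_maps[of T]]
    by (simp add: T)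
  then show ?thesis
    using g by auto
qed

definition Inn_orbit :: "'a \<Rightarrow> 'a set" where
  "Inn_orbit x = (\<lambda>g. g x) ` carrier (quandle_Inn X qop)"

lemma quandle_orbits_eq: "quandle_orbits X qop = Inn_orbit ` X"
  by (auto simp: quandle_orbits_def orbits_def orbit_def Inn_orbit_def)

lemma Inn_orbit_refl: "x \<in> X \<Longrightarrow> x \<in> Inn_orbit x"
proof -
  assume "x \<in> X"
  moreover have "(\<lambda>x\<in>X. x) \<in> carrier (quandle_Inn X qop)"
    using subgroup.one_closed[OF subgroup_Inn] by (simp add: quandle_Aut_def BijGroup_def)
  ultimately show ?thesis
    unfolding Inn_orbit_def by (intro image_eqI[of _ _ "\<lambda>x\<in>X. x"]) simp_all
qed

lemma Inn_orbit_subset: "x \<in> X \<Longrightarrow> Inn_orbit x \<subseteq> X"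
  using Inn_subset_Bij Bij_imp_funcset by (fastforce simp: Inn_orbit_def)

section \<open>Two orbits, one of them a fixed point\<close>

context
  fixes X1 a
  assumes orbits: "quandle_orbits X qop = {X1, {a}}" and X1_ne: "X1 \<noteq> {a}"
begin

lemma fixed_point: "a \<in> X" "Inn_orbit a = {a}"
proof -
  have "{a} \<in> Inn_orbit ` X"
    using orbits unfolding quandle_orbits_eq by simp
  then obtain z where z: "z \<in> X" "Inn_orbit z = {a}"
    by (metis imageE)
  then have "z = a"
    using Inn_orbit_refl by blast
  then show "a \<in> X" "Inn_orbit a = {a}"
    using z by auto
qed

lemma Inn_fixes: "g \<in> carrier (quandle_Inn X qop) \<Longrightarrow> g a = a"
  using fixed_point(2) by (auto simp: Inn_orbit_def)

lemma fixed_point_notin: "a \<notin> X1"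
proof
  assume a: "a \<in> X1"
  have "X1 \<in> Inn_orbit ` X"
    using orbits unfolding quandle_orbits_eq by simp
  then obtain z where z: "z \<in> X" "Inn_orbit z = X1"
    by blast
  then obtain g where g: "g \<in> carrier (quandle_Inn X qop)" "g z = a"
    using a by (auto simp: Inn_orbit_def)
  then have "g z = g a"
    using Inn_fixes[OF g(1)] by simp
  moreover have "inj_on g X"
    using g Inn_subset_Bij by (auto simp: Bij_def bij_betw_def)
  ultimately have "z = a"
    using z fixed_point by (auto dest: inj_onD)
  \<comment> \<open>Now \<open>X1\<close> is the orbit of \<open>a\<close>, that is
    \<open>{a}\<close>. The assumption \<open>X1_ne\<close> excludes exactly this collapse of
    \<open>{X1, {a}}\<close> to a single orbit.\<close>
  then show False
    using z fixed_point X1_ne by simp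
qed

lemma carrier_decomp: "X = insert a X1"
proof
  have "X1 \<in> Inn_orbit ` X"
    using orbits unfolding quandle_orbits_eq by simp
  then show "insert a X1 \<subseteq> X"
    using fixed_point(1) Inn_orbit_subset by blast
  show "X \<subseteq> insert a X1"
  proof
    fix x assume x: "x \<in> X"
    then have "Inn_orbit x \<in> {X1, {a}}"
      using orbits unfolding quandle_orbits_eq by blast
    then show "x \<in> insert a X1"
      using Inn_orbit_refl[OF x] by auto
  qed
qed

lemma big_orbit_nonempty: "X1 \<noteq> {}"
proof -
  have "X1 \<in> Inn_orbit ` X"
    using orbits unfolding quandle_orbits_eq by simp
  then show ?thesis
    using Inn_orbit_refl by blast
qed

lemma Inn_transitive:
  assumes "x \<in> X1" "y \<in> X1"
  obtains g where "g \<in> carrier (quandle_Inn X qop)" "g x = y"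
proof -
  have x: "x \<in> X" "x \<noteq> a"
    using assms carrier_decomp fixed_point_notin by auto
  then have "Inn_orbit x \<in> {X1, {a}}"
    using orbits unfolding quandle_orbits_eq by blast
  then have "Inn_orbit x = X1"
    using Inn_orbit_refl[OF x(1)] x(2) by auto
  then show thesis
    using assms that by (auto simp: Inn_orbit_def)
qed

lemma top_less_dichotomy:
  assumes fin: "finite X" and T: "topspace T = X" and t0: "t0_space T"
    and nd: "T \<noteq> discrete_topology X" and rc: "right_continuous X qop T"
  shows "(\<forall>x y. top_less T x y \<longleftrightarrow> x \<in> X1 \<and> y = a) \<or> (\<forall>x y. top_less T x y \<longleftrightarrow> x = a \<and> y \<in> X1)"
proof -
  have finT: "finite (topspace T)"
    using fin T by simp
  note homeo = Inn_homeomorphic_map[OF fin T rc]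
  have incomparable: "\<not> top_less T x y" if xy: "x \<in> X1" "y \<in> X1" for x y
  proof
    assume "top_less T x y"
    then have "card (min_open T y) < card (min_open T x)"
      by (rule top_less_card_less[OF finT t0])
    \<comment> \<open>Choosing \<open>g\<close> to carry the upper point \<open>y\<close> back to
      \<open>x\<close> bounds the larger neighbourhood by the smaller one.\<close>
    moreover obtain g where "g \<in> carrier (quandle_Inn X qop)" "g y = x"
      using Inn_transitive xy by blast
    then have "card (min_open T x) \<le> card (min_open T y)"
      using homeomorphic_map_card_min_open[OF finT homeo, of g y] xy T carrier_decomp by auto
    ultimately show False by simp
  qed
  have in_X: "x \<in> insert a X1 \<and> y \<in> insert a X1 \<and> x \<noteq> y" if "top_less T x y" for x y
    using that T carrier_decomp by (auto simp: top_less_def top_le_def)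
  \<comment> \<open>An inner automorphism moving \<open>x\<close> to \<open>x'\<close> preserves the
    order and fixes \<open>a\<close>; the same argument gives \<open>above\<close>.\<close>
  have below: "top_less T x' a" if less: "top_less T x a" and mem: "x \<in> X1" "x' \<in> X1" for x x'
  proof -
    obtain g where g: "g \<in> carrier (quandle_Inn X qop)" "g x = x'"
      using Inn_transitive[OF mem] .
    show ?thesis
      using homeomorphic_map_top_less[OF finT homeo[OF g(1)] less] g(2) Inn_fixes[OF g(1)] by simp
  qed
  have above: "top_less T a x'" if less: "top_less T a x" and mem: "x \<in> X1" "x' \<in> X1" for x x'
  proof -
    obtain g where g: "g \<in> carrier (quandle_Inn X qop)" "g x = x'"
      using Inn_transitive[OF mem] .
    show ?thesis
      using homeomorphic_map_top_less[OF finT homeo[OF g(1)] less] g(2) Inn_fixes[OF g(1)] by simp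
  qed
  have not_both: "\<not> (top_less T x a \<and> top_less T a y)" if "x \<in> X1" "y \<in> X1" for x y
  proof
    assume *: "top_less T x a \<and> top_less T a y"
    \<comment> \<open>The strict drop in cardinality shows \<open>x \<noteq> y\<close>, as
      \<open>top_less_trans\<close> requires.\<close>
    then have "card (min_open T y) < card (min_open T x)"
      using top_less_card_less[OF finT t0] less_trans by blast
    then have "top_less T x y"
      using * top_less_trans[of T x a y] by blast
    then show False
      using incomparable that by blast
  qed
  obtain x y where xy: "top_less T x y"
    using nondiscrete_iff_comparable[OF finT] nd T by auto
  then consider "x \<in> X1" "y = a" | "x = a" "y \<in> X1"
    using in_X incomparable by blast
  then show ?thesis
  proof cases
    case 1
    then show ?thesis
      using xy below in_X incomparable not_both by blast
  next
    case 2
    then show ?thesis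
      using xy above in_X incomparable not_both by blast
  qed
qed

end

end

section \<open>Existence: the up-sets of the order whose only strict relations are
  \<open>x < a\<close>\<close>

definition particular_point_topology :: "'a set \<Rightarrow> 'a \<Rightarrow> 'a topology" where
  "particular_point_topology X a = topology (\<lambda>U. U \<subseteq> X \<and> (U = {} \<or> a \<in> U))"

lemma openin_particular_point_topology:
  "openin (particular_point_topology X a) U \<longleftrightarrow> U \<subseteq> X \<and> (U = {} \<or> a \<in> U)"
proof -
  have "istopology (\<lambda>U. U \<subseteq> X \<and> (U = {} \<or> a \<in> U))"
    unfolding istopology_def by blast
  then show ?thesis
    by (simp add: particular_point_topology_def)
qed

lemma topspace_particular_point_topology:
  "a \<in> X \<Longrightarrow> topspace (particular_point_topology X a) = X"
  by (auto simp: topspace_def openin_particular_point_topology)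

lemma t0_space_particular_point_topology:
  assumes "a \<in> X"
  shows "t0_space (particular_point_topology X a)"
  unfolding t0_space_def topspace_particular_point_topology[OF assms]
    openin_particular_point_topology
proof (intro ballI impI)
  fix x y assume xy: "x \<in> X" "y \<in> X" "x \<noteq> y"
  show "\<exists>U. (U \<subseteq> X \<and> (U = {} \<or> a \<in> U)) \<and> (x \<notin> U) = (y \<in> U)"
  proof (cases "x = a")
    case True
    then show ?thesis using xy by (intro exI[of _ "{a}"]) auto
  next
    case False
    \<comment> \<open>Adding \<open>a\<close> makes the set open, and \<open>x\<close> still lies
      outside it.\<close>
    then show ?thesis using xy assms by (intro exI[of _ "{y, a}"]) auto
  qed
qed

lemma top_less_particular_point_topology:
  assumes "a \<in> X" "x \<in> X" "x \<noteq> a"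
  shows "top_less (particular_point_topology X a) x a"
proof -
  have "min_open (particular_point_topology X a) a \<subseteq> {a}"
    by (rule min_open_subset) (auto simp: openin_particular_point_topology assms)
  moreover have "a \<in> min_open (particular_point_topology X a) x"
    by (auto simp: min_open_def openin_particular_point_topology)
  ultimately show ?thesis
    using assms by (auto simp: top_less_def top_le_def topspace_particular_point_topology)
qed

text \<open>Since each \<open>R_y\<close> fixes \<open>a\<close>, the preimage of a set containing
  \<open>a\<close> again contains \<open>a\<close>.\<close>

lemma (in quandle) right_continuous_particular_point_topology:
  assumes "a \<in> X" "\<And>y. y \<in> X \<Longrightarrow> a \<star> y = a"
  shows "right_continuous X qop (particular_point_topology X a)"
  using assms closed
  by (auto simp: right_continuous_def continuous_map_def right_mult_def
      topspace_particular_point_topology openin_particular_point_topology)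

text \<open>The reversed order, with \<open>a\<close> below all of \<open>X1\<close>, is preserved
  by inner automorphisms too. Uniqueness is therefore claimed for the direction
  \<open>x < a\<close>, and the second conjunct leaves the reversed order as the only
  alternative.\<close>

theorem proposition4p6:
  fixes X X1 :: "'a set" and qop :: "'a \<Rightarrow> 'a \<Rightarrow> 'a" and a :: 'a
  assumes "quandle X qop"
    and "finite X"
    and "quandle_orbits X qop = {X1, {a}}"
    and "X1 \<noteq> {a}"
  shows "(\<exists>!T. topspace T = X \<and> t0_space T \<and> T \<noteq> discrete_topology X
            \<and> right_continuous X qop T
            \<and> (\<forall>x\<in>X1. top_less T x a))
       \<and> (\<forall>T. topspace T = X \<and> t0_space T \<and> T \<noteq> discrete_topology X
            \<and> right_continuous X qop T
            \<longrightarrow> (\<forall>x y. top_less T x y \<longleftrightarrow> x \<in> X1 \<and> y = a)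
              \<or> (\<forall>x y. top_less T x y \<longleftrightarrow> x = a \<and> y \<in> X1))"
proof -
  interpret quandle X qop by fact
  note fin = assms(2) and orb = assms(3,4)
  note a = fixed_point(1)[OF orb] and decomp = carrier_decomp[OF orb]
    and notin = fixed_point_notin[OF orb]
  let ?good = "\<lambda>T. topspace T = X \<and> t0_space T \<and> T \<noteq> discrete_topology X
            \<and> right_continuous X qop T \<and> (\<forall>x\<in>X1. top_less T x a)"
  let ?P = "particular_point_topology X a"
  obtain x0 where x0: "x0 \<in> X1"
    using big_orbit_nonempty[OF orb] by blast
  have dichotomy: "(\<forall>x y. top_less T x y \<longleftrightarrow> x \<in> X1 \<and> y = a) \<or> (\<forall>x y. top_less T x y \<longleftrightarrow> x = a \<and> y \<in> X1)"
    if "topspace T = X \<and> t0_space T \<and> T \<noteq> discrete_topology X \<and> right_continuous X qop T" for T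
    using top_less_dichotomy[OF orb fin] that by blast
  have "?good ?P"
  proof -
    have "qop a y = a" if "y \<in> X" for y
      using Inn_fixes[OF orb right_mult_in_Inn[OF that]] a by (simp add: right_mult_def)
    then have "right_continuous X qop ?P"
      using right_continuous_particular_point_topology a by blast
    moreover have less: "\<forall>x\<in>X1. top_less ?P x a"
      using top_less_particular_point_topology[OF a] decomp notin by blast
    moreover have "?P \<noteq> discrete_topology X"
      using nondiscrete_iff_comparable[of ?P] less x0 fin
      by (auto simp: topspace_particular_point_topology[OF a])
    ultimately show ?thesis
      using topspace_particular_point_topology[OF a] t0_space_particular_point_topology[OF a]
      by blast
  qed
  \<comment> \<open>The point \<open>x0\<close> decides the dichotomy: \<open>x0 < a\<close> under
    the reversed order would force \<open>x0 = a\<close>, contrary to \<open>notin\<close>.\<close>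
  moreover have less_iff: "top_less T x y \<longleftrightarrow> x \<in> X1 \<and> y = a" if "?good T" for T x y
    using dichotomy[of T] that x0 notin by blast
  have "S = T" if "?good S" "?good T" for S T
    using topology_eq_if_top_less_eq[of S T] less_iff[OF that(1)] less_iff[OF that(2)] that fin
    by simp
  ultimately have "\<exists>!T. ?good T"
    by blast
  then show ?thesis
    using dichotomy by blast
qed

end
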